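(* For all positive integers $n$ and $q$ and all subsets $B_1\subseteq[q,n+q-1]$ and $B_2\subseteq[q,n+q-1]$, $$\sum_{\{\pi\in S_{n+q-1}\mid Des_q(\pi^{-1})=B_1,\ Del_q(\pi^{-1})=B_2\}} t^{inv_q(\pi)}=\sum_{\{\pi\in S_{n+q-1}\mid Des_q(\pi^{-1})=B_1,\ Del_q(\pi^{-1})=B_2\}} t^{rmaj_{q,n+q-1}(\pi)}.$$
   Context: $t$ is an indeterminate; $[a,b]$ denotes the set of integers $i$ with $a\le i\le b$. Let $m=n+q-1$ and $\pi\in S_m$. The $q$-inversion number: $inv_q(\pi)=\sum_{i=q+1}^m \min\{\,i-q,\ \#\{j<i\mid \pi(j)>\pi(i)\}\,\}$ (equal to $0$ if $m\le q$). $Del_q(\pi)=\{ i \mid q+1\le i\le m,\ \#\{j<i\mid \pi(j)<\pi(i)\}\le q-1\}$. The $q$-descent set $Des_q(\pi)$ is the set of $i$ with $q\le i\le m-1$ such that $\pi(i)>\pi(i+1)$ or $i+1\in Del_q(\pi)$ (or both). The $q$-reverse major index: $rmaj_{q,m}(\pi)=\sum_{i\in Des_q(\pi)}(m-i)$. *)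

theory Defs
  imports "HOL-Combinatorics.Permutations" "HOL-Computational_Algebra.Polynomial"
begin

text \<open>
  A permutation of \<open>{1..m}\<close> is a function \<open>\<pi> :: nat \<Rightarrow> nat\<close> with \<open>\<pi> permutes {1..m}\<close>; the
  degree \<open>m\<close> is passed explicitly to each statistic. For \<open>q \<ge> 1\<close> no subtraction below
  truncates: \<open>i - q\<close> occurs only with \<open>i > q\<close>, and \<open>m - i\<close> only with \<open>i < m\<close>.
\<close>

definition inv_q :: "nat \<Rightarrow> nat \<Rightarrow> (nat \<Rightarrow> nat) \<Rightarrow> nat" where
  "inv_q q m \<pi> = (\<Sum>i = q + 1..m. min (i - q) (card {j \<in> {1..<i}. \<pi> j > \<pi> i}))"

definition Del_q :: "nat \<Rightarrow> nat \<Rightarrow> (nat \<Rightarrow> nat) \<Rightarrow> nat set" where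
  "Del_q q m \<pi> = {i \<in> {q + 1..m}. card {j \<in> {1..<i}. \<pi> j < \<pi> i} \<le> q - 1}"

definition Des_q :: "nat \<Rightarrow> nat \<Rightarrow> (nat \<Rightarrow> nat) \<Rightarrow> nat set" where
  "Des_q q m \<pi> = {i \<in> {q..<m}. \<pi> i > \<pi> (i + 1) \<or> i + 1 \<in> Del_q q m \<pi>}"

definition rmaj_q :: "nat \<Rightarrow> nat \<Rightarrow> (nat \<Rightarrow> nat) \<Rightarrow> nat" where
  "rmaj_q q m \<pi> = (\<Sum>i \<in> Des_q q m \<pi>. m - i)"

end

theory Submission
  imports Defs "HOL-Combinatorics.Multiset_Permutations"
begin

text \<open>
  Throughout, \<open>k = q - 1\<close>. Insert the letters \<open>\<pi> 1, \<pi> 2, \<dots>\<close> of a permutation of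
  \<open>{1..n + k}\<close> one after the other and record for each its rank \<open>x\<close> among the letters read so far.
  The sequence of ranks is an arbitrary sequence with \<open>i\<close>-th entry in \<open>{1..i}\<close>, and it determines
  \<open>\<pi>\<close>. All four statistics treat the ranks \<open>1, \<dots>, Suc k\<close> alike: replacing every rank
  \<open>x\<close> by \<open>max (x - k) 1\<close> and forgetting the first \<open>k\<close> entries yields the rank sequence of a
  permutation \<open>\<sigma>\<close> of \<open>{1..n}\<close>, and the \<open>q\<close>-statistics of \<open>\<pi>\<close> are those of
  \<open>\<sigma>\<close> for \<open>q = 1\<close>, up to translating sets by \<open>k\<close>. For the inversion number and the reverse
  major index this is read off entry by entry (\<open>inv_q_reduce\<close>, \<open>rmaj_q_reduce\<close>). For the two sets
  belonging to \<open>inv \<pi>\<close> it follows by induction on the number of inserted letters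
  (\<open>min_letters_reduce\<close>, \<open>inv_descents_reduce\<close>): a new letter of rank at most \<open>Suc k\<close> changes
  them in the same way whatever its rank is.

  A sequence of length \<open>n\<close> arises from \<open>k! * q ^ r\<close> sequences of length \<open>n + k\<close>, where \<open>r\<close> is
  its number of ones (\<open>sum_codes_reduce\<close>). This weight is not constant, but \<open>r\<close> is the number of
  left-to-right minima of \<open>\<sigma>\<close>, so it depends only on one of the two sets that are being prescribed.

  What remains is the case \<open>q = 1\<close>: equidistribution of the inversion number and the reverse
  major index over permutations with given inverse descents and given left-to-right minima.
  Foata's bijection does this. In the mirrored form used here it builds the image by prepending
  letters; before \<open>x\<close> is prepended, the word is cut into blocks and each block is rotated by
  one place, which corrects the inversion number by exactly the missing amount (\<open>invs_foata\<close>).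
  A rotation never changes the relative order of two letters below \<open>x\<close> or of two letters above
  \<open>x\<close>, and consecutive values lie on the same side of any third value; hence inverse
  descents and left-to-right minima survive (\<open>inv_descents_foata\<close>, \<open>min_letters_foata\<close>).
\<close>

section \<open>Statistics on words\<close>

fun pairs :: "('a \<Rightarrow> 'a \<Rightarrow> bool) \<Rightarrow> 'a list \<Rightarrow> nat" where
  "pairs R [] = 0"
| "pairs R (x # w) = length (filter (R x) w) + pairs R w"

abbreviation invs :: "nat list \<Rightarrow> nat" where
  "invs \<equiv> pairs (\<lambda>x y. y < x)"

fun rmaj :: "nat list \<Rightarrow> nat" where
  "rmaj [] = 0"
| "rmaj (x # w) = (if w \<noteq> [] \<and> hd w < x then length w else 0) + rmaj w"

fun smaller_before :: "nat \<Rightarrow> nat list \<Rightarrow> nat" where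
  "smaller_before v [] = 0"
| "smaller_before v (x # w) =
     (if x = v then 0 else (if x < v then 1 else 0) + smaller_before v w)"

fun precedes :: "nat \<Rightarrow> nat \<Rightarrow> nat list \<Rightarrow> bool" where
  "precedes a b [] \<longleftrightarrow> False"
| "precedes a b (x # w) \<longleftrightarrow> x = a \<and> b \<in> set w \<or> precedes a b w"

text \<open>
  Stated in terms of the word of \<open>\<pi>\<close>, these are \<open>Del_q\<close> and \<open>Des_q\<close> of \<open>inv \<pi>\<close> for
  \<open>q = Suc k\<close>, without their lower bounds on the letters. Below these bounds every letter qualifies
  (for \<open>inv_descents\<close>, every letter but the largest), which makes the recursion under insertion uniform. For \<open>k = 0\<close> they are the left-to-right minima
  and the letters \<open>v\<close> standing to the right of \<open>Suc v\<close>.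
\<close>

definition min_letters :: "nat \<Rightarrow> nat list \<Rightarrow> nat set" where
  "min_letters k w = {v \<in> set w. smaller_before v w \<le> k}"

definition inv_descents :: "nat \<Rightarrow> nat list \<Rightarrow> nat set" where
  "inv_descents k w =
     {v \<in> set w. Suc v \<in> set w \<and> (precedes (Suc v) v w \<or> Suc v \<in> min_letters k w)}"

section \<open>Rotating blocks\<close>

text \<open>
  Cut the word in front of every letter satisfying \<open>P\<close>, and move the first letter of each block
  to the end of the block. The first letter of the word is treated as the start of a block in any
  case, so the description is faithful for words that satisfy \<open>starts P\<close>.
\<close>

function rot :: "('a \<Rightarrow> bool) \<Rightarrow> 'a list \<Rightarrow> 'a list" where
  "rot P [] = []"
| "rot P (a # w) =
     takeWhile (\<lambda>y. \<not> P y) w @ a # rot P (dropWhile (\<lambda>y. \<not> P y) w)"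
  by pat_completeness auto
termination
  by (relation "measure (\<lambda>(P, w). length w)") (auto simp: le_imp_less_Suc length_dropWhile_le)

definition starts :: "('a \<Rightarrow> bool) \<Rightarrow> 'a list \<Rightarrow> bool" where
  "starts P w \<longleftrightarrow> w = [] \<or> P (hd w)"

lemma starts_simps [simp]: "starts P []" "starts P (a # w) \<longleftrightarrow> P a"
  by (auto simp: starts_def)

lemma starts_dropWhile [simp]: "starts P (dropWhile (\<lambda>y. \<not> P y) w)"
  using hd_dropWhile[of "\<lambda>y. \<not> P y" w] by (auto simp: starts_def)

lemma mset_rot [simp]: "mset (rot P w) = mset w"
proof (induction P w rule: rot.induct)
  case (2 P a w)
  have "mset w = mset (takeWhile (\<lambda>y. \<not> P y) w) + mset (dropWhile (\<lambda>y. \<not> P y) w)"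
    by (metis mset_append takeWhile_dropWhile_id)
  then show ?case using 2 by simp
qed simp

lemma set_rot [simp]: "set (rot P w) = set w"
  by (metis mset_rot set_mset_mset)

lemma length_rot [simp]: "length (rot P w) = length w"
  by (metis mset_rot size_mset)

lemma rot_eq_Nil [simp]: "rot P w = [] \<longleftrightarrow> w = []"
  by (metis length_0_conv length_rot)

lemma filter_rot:
  assumes "starts P w"
  shows "filter P (rot P w) = filter P w"
    and "filter (\<lambda>y. \<not> P y) (rot P w) = filter (\<lambda>y. \<not> P y) w"
proof -
  have "filter P (rot P w) = filter P w \<and>
        filter (\<lambda>y. \<not> P y) (rot P w) = filter (\<lambda>y. \<not> P y) w"
    using assms
  proof (induction P w rule: rot.induct)
    case (2 P a w)
    let ?t = "takeWhile (\<lambda>y. \<not> P y) w" and ?d = "dropWhile (\<lambda>y. \<not> P y) w"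
    have w: "w = ?t @ ?d" by simp
    have t: "filter P ?t = []" "filter (\<lambda>y. \<not> P y) ?t = ?t"
      by (auto simp: filter_empty_conv filter_id_conv dest: set_takeWhileD)
    have "filter P w = filter P ?d" "filter (\<lambda>y. \<not> P y) w = ?t @ filter (\<lambda>y. \<not> P y) ?d"
      using t w by (metis append_Nil filter_append, metis filter_append)
    then show ?case using 2 t by simp
  qed simp
  then show "filter P (rot P w) = filter P w"
    and "filter (\<lambda>y. \<not> P y) (rot P w) = filter (\<lambda>y. \<not> P y) w" by auto
qed

lemma last_rot: "starts P w \<Longrightarrow> w \<noteq> [] \<Longrightarrow> P (last (rot P w))"
proof (induction P w rule: rot.induct)
  case (2 P a w)
  then show ?case by (cases "dropWhile (\<lambda>y. \<not> P y) w = []") auto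
qed simp

text \<open>
  The condition on \<open>v\<close> makes the seam between the two words a boundary between blocks.
\<close>

lemma rot_append: "starts P v \<Longrightarrow> rot P (u @ v) = rot P u @ rot P v"
proof (induction P u rule: rot.induct)
  case (2 P a u)
  show ?case
  proof (cases "\<exists>y\<in>set u. P y")
    case True
    then show ?thesis using 2 by (auto simp: takeWhile_append1 dropWhile_append1)
  next
    case False
    then have "takeWhile (\<lambda>y. \<not> P y) u = u" "dropWhile (\<lambda>y. \<not> P y) u = []"
      by (simp_all add: takeWhile_eq_all_conv)
    moreover from False
    have "takeWhile (\<lambda>y. \<not> P y) (u @ v) = u @ takeWhile (\<lambda>y. \<not> P y) v"
      "dropWhile (\<lambda>y. \<not> P y) (u @ v) = dropWhile (\<lambda>y. \<not> P y) v"
      by (auto intro: takeWhile_append2 dropWhile_append2)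
    moreover have "takeWhile (\<lambda>y. \<not> P y) v = []" "dropWhile (\<lambda>y. \<not> P y) v = v"
      using 2(2) by (cases v; auto)+
    ultimately show ?thesis by (auto simp: takeWhile_eq_all_conv[THEN iffD2])
  qed
qed simp

text \<open>
  Rotated blocks end in a letter satisfying \<open>P\<close>, so in the reversed word they start with one and
  the same operation undoes the rotation. This gives injectivity of the rotation without a
  separate inverse function.
\<close>

lemma rot_rev_rot: "starts P w \<Longrightarrow> rot P (rev (rot P w)) = rev w"
proof (induction P w rule: rot.induct)
  case (2 P a w)
  let ?t = "takeWhile (\<lambda>y. \<not> P y) w" and ?d = "dropWhile (\<lambda>y. \<not> P y) w"
  have t: "\<forall>y\<in>set ?t. \<not> P y" by (auto dest: set_takeWhileD)
  have "rot P (rev (rot P (a # w))) = rot P (rev (rot P ?d) @ (a # rev ?t))" by simp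
  also have "\<dots> = rot P (rev (rot P ?d)) @ rot P (a # rev ?t)"
    using 2(2) by (intro rot_append) auto
  also have "rot P (rev (rot P ?d)) = rev ?d" using 2(1) by simp
  also have "rot P (a # rev ?t) = rev ?t @ [a]"
  proof -
    have "takeWhile (\<lambda>y. \<not> P y) (rev ?t) = rev ?t" "dropWhile (\<lambda>y. \<not> P y) (rev ?t) = []"
      using t by (auto simp: takeWhile_eq_all_conv dropWhile_eq_Nil_conv)
    then show ?thesis by simp
  qed
  also have "rev ?d @ rev ?t @ [a] = rev (a # w)"
    by (metis append_assoc rev.simps(2) rev_append takeWhile_dropWhile_id)
  finally show ?case .
qed simp

lemma rot_inject:
  "starts P v \<Longrightarrow> starts P w \<Longrightarrow> rot P v = rot P w \<Longrightarrow> v = w"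
  by (metis rot_rev_rot rev_rev_ident)

lemma pairs_append:
  "pairs R (u @ v) = pairs R u + pairs R v + (\<Sum>b\<leftarrow>u. length (filter (R b) v))"
  by (induction u) auto

text \<open>
  Rotating a block moves its first letter, which satisfies \<open>P\<close>, past all the others, which do not;
  each of the latter contributes one new pair. Pairs in different blocks are unaffected, because
  blocks keep their letters and their order.
\<close>

lemma pairs_rot:
  assumes "starts P w" and R: "\<And>a b. P a \<Longrightarrow> \<not> P b \<Longrightarrow> R b a \<and> \<not> R a b"
  shows "pairs R (rot P w) = pairs R w + length (filter (\<lambda>y. \<not> P y) w)"
  using assms
proof (induction P w rule: rot.induct)
  case (2 P a w)
  let ?t = "takeWhile (\<lambda>y. \<not> P y) w" and ?d = "dropWhile (\<lambda>y. \<not> P y) w"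
  have t: "R b a \<and> \<not> R a b" if "b \<in> set ?t" for b
    using that "2.prems" by (auto dest: set_takeWhileD)
  have before: "filter (R a) ?t = []"
    using t by (auto simp: filter_empty_conv)
  \<comment> \<open>The gain within the first block: each remaining letter now precedes \<open>a\<close>.\<close>
  have after: "(\<Sum>b\<leftarrow>?t. length (filter (R b) (a # v))) =
       length ?t + (\<Sum>b\<leftarrow>?t. length (filter (R b) v))" for v
  proof -
    have "\<forall>b\<in>set u. R b a \<Longrightarrow> (\<Sum>b\<leftarrow>u. length (filter (R b) (a # v))) =
       length u + (\<Sum>b\<leftarrow>u. length (filter (R b) v))" for u
      by (induction u) auto
    then show ?thesis using t by blast
  qed
  have small: "filter (\<lambda>y. \<not> P y) w = ?t @ filter (\<lambda>y. \<not> P y) ?d"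
  proof -
    have "filter (\<lambda>y. \<not> P y) ?t = ?t"
      by (auto simp: filter_id_conv dest: set_takeWhileD)
    then show ?thesis by (metis filter_append takeWhile_dropWhile_id)
  qed
  have m: "length (filter Q (rot P ?d)) = length (filter Q ?d)" for Q
    by (metis mset_filter mset_rot size_mset)
  have IH: "pairs R (rot P ?d) = pairs R ?d + length (filter (\<lambda>y. \<not> P y) ?d)"
    using "2.IH" "2.prems" by simp
  have "pairs R (rot P (a # w)) = pairs R ?t + pairs R (a # rot P ?d) +
      (\<Sum>b\<leftarrow>?t. length (filter (R b) (a # rot P ?d)))"
    by (simp only: rot.simps pairs_append)
  also have "\<dots> = pairs R ?t + length (filter (R a) ?d) + pairs R ?d
      + length (filter (\<lambda>y. \<not> P y) ?d)
      + length ?t + (\<Sum>b\<leftarrow>?t. length (filter (R b) ?d))"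
    unfolding after by (simp add: m IH)
  also have "\<dots> = length (filter (R a) (?t @ ?d)) + pairs R (?t @ ?d) +
      (length ?t + length (filter (\<lambda>y. \<not> P y) ?d))"
    unfolding pairs_append filter_append length_append before by simp
  also have "\<dots> = pairs R (a # w) + length (filter (\<lambda>y. \<not> P y) (a # w))"
    using small "2.prems" by simp
  finally show ?case .
qed simp

text \<open>
  This turns a gain of ascending pairs under \<open>pairs_rot\<close> into a loss of inversions.
\<close>

lemma pairs_less_greater:
  "distinct w \<Longrightarrow> pairs (<) w + invs w = length w choose 2"
proof (induction w)
  case (Cons x w)
  have "length (filter ((<) x) w) + length (filter (\<lambda>y. y < x) w) = length w"
    using Cons.prems by (induction w) auto
  then show ?case using Cons by (simp add: numeral_2_eq_2)
qed simp

section \<open>Foata's bijection\<close>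

text \<open>
  Prepending \<open>x\<close> to \<open>w\<close> creates as many inversions as \<open>w\<close> has letters below \<open>x\<close>, while
  the reverse major index grows by \<open>length w\<close> or by \<open>0\<close>, according to whether \<open>x\<close> exceeds
  the first letter. The difference is the number of letters above \<open>x\<close> in the first case, and minus
  the number of letters below \<open>x\<close> in the second; the two rotations supply exactly these.
\<close>

definition foata_step :: "nat \<Rightarrow> nat list \<Rightarrow> nat list" where
  "foata_step x w =
     (if w \<noteq> [] \<and> hd w < x then rot (\<lambda>y. y < x) w else rot (\<lambda>y. x < y) w)"

fun foata :: "nat list \<Rightarrow> nat list" where
  "foata [] = []"
| "foata (x # w) = x # foata_step x (foata w)"

lemma mset_foata_step [simp]: "mset (foata_step x w) = mset w"
  by (simp add: foata_step_def)

lemma set_foata_step [simp]: "set (foata_step x w) = set w"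
  by (simp add: foata_step_def)

lemma mset_foata [simp]: "mset (foata w) = mset w"
  by (induction w) auto

lemma set_foata [simp]: "set (foata w) = set w"
  by (metis mset_foata set_mset_mset)

lemma distinct_foata [simp]: "distinct (foata w) = distinct w"
  using mset_eq_imp_distinct_iff mset_foata by blast

lemma length_foata [simp]: "length (foata w) = length w"
  by (metis mset_foata size_mset)

lemma foata_eq_Nil [simp]: "foata w = [] \<longleftrightarrow> w = []"
  by (metis length_0_conv length_foata)

text \<open>
  Keeping the first letter is what makes the case distinction in \<open>foata_step\<close>, taken on the image of
  the word built so far, agree with the descent condition for the word itself.
\<close>

lemma hd_foata: "hd (foata w) = hd w"
  by (cases w) auto

lemma starts_step:
  fixes x :: nat
  assumes "x \<notin> set w"
  shows "if w \<noteq> [] \<and> hd w < x then starts (\<lambda>y. y < x) w else starts (\<lambda>y. x < y) w"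
  using assms by (cases w) (auto simp: neq_iff)

lemma invs_foata_step:
  assumes "distinct w" "x \<notin> set w"
  shows "invs (foata_step x w) + length (filter (\<lambda>y. y < x) w) =
         invs w + (if w \<noteq> [] \<and> hd w < x then length w else 0)"
proof (cases "w \<noteq> [] \<and> hd w < x")
  case True
  have "invs (rot (\<lambda>y. y < x) w) = invs w + length (filter (\<lambda>y. \<not> y < x) w)"
    using starts_step[OF assms(2)] True by (intro pairs_rot) auto
  then show ?thesis
    using True sum_length_filter_compl[of "\<lambda>y. y < x" w] by (simp add: foata_step_def)
next
  case False
  have "pairs (<) (rot (\<lambda>y. x < y) w) = pairs (<) w + length (filter (\<lambda>y. \<not> x < y) w)"
    using starts_step[OF assms(2)] False by (intro pairs_rot) auto
  moreover have "filter (\<lambda>y. \<not> x < y) w = filter (\<lambda>y. y < x) w"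
    using assms(2) by (intro filter_cong) (auto simp: not_less le_less)
  moreover have "distinct (rot (\<lambda>y. x < y) w)"
    using assms(1) mset_eq_imp_distinct_iff mset_rot by blast
  ultimately show ?thesis
    using False pairs_less_greater[of "rot (\<lambda>y. x < y) w"] pairs_less_greater[OF assms(1)]
    by (auto simp: foata_step_def)
qed

lemma invs_foata: "distinct w \<Longrightarrow> invs (foata w) = rmaj w"
proof (induction w)
  case (Cons x w)
  have "length (filter (\<lambda>y. y < x) (foata_step x (foata w))) =
        length (filter (\<lambda>y. y < x) (foata w))"
    by (metis mset_filter mset_foata_step size_mset)
  then show ?case
    using Cons invs_foata_step[of "foata w" x] by (auto simp: hd_foata)
qed simp

text \<open>
  The rotation only moves letters below \<open>x\<close> past letters above \<open>x\<close> or vice versa.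
\<close>

lemma filter_foata_step:
  assumes "x \<notin> set w"
  shows "filter (\<lambda>y. y < x) (foata_step x w) = filter (\<lambda>y. y < x) w"
    and "filter (\<lambda>y. x < y) (foata_step x w) = filter (\<lambda>y. x < y) w"
proof -
  have compl: "filter (\<lambda>y. \<not> y < x) u = filter (\<lambda>y. x < y) u"
    "filter (\<lambda>y. \<not> x < y) u = filter (\<lambda>y. y < x) u" if "set u = set w" for u
    using assms that by (auto intro!: filter_cong simp: not_less le_less)
  have "filter (\<lambda>y. y < x) (foata_step x w) = filter (\<lambda>y. y < x) w \<and>
    filter (\<lambda>y. x < y) (foata_step x w) = filter (\<lambda>y. x < y) w"
  proof (cases "w \<noteq> [] \<and> hd w < x")
    case True
    then have step: "foata_step x w = rot (\<lambda>y. y < x) w" and "starts (\<lambda>y. y < x) w"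
      using starts_step[OF assms] by (simp_all add: foata_step_def)
    from filter_rot[OF this(2)] show ?thesis
      unfolding step using compl(1)[of w] compl(1)[of "rot (\<lambda>y. y < x) w"] by simp
  next
    case False
    then have step: "foata_step x w = rot (\<lambda>y. x < y) w" and "starts (\<lambda>y. x < y) w"
      using starts_step[OF assms] unfolding foata_step_def by (simp_all only: False if_False)
    from filter_rot[OF this(2)] show ?thesis
      unfolding step using compl(2)[of w] compl(2)[of "rot (\<lambda>y. x < y) w"] by simp
  qed
  then show "filter (\<lambda>y. y < x) (foata_step x w) = filter (\<lambda>y. y < x) w"
    "filter (\<lambda>y. x < y) (foata_step x w) = filter (\<lambda>y. x < y) w" by auto
qed

text \<open>
  The last letter of the image starts a block of the original word, so it tells which of the two
  rotations was applied.
\<close>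

lemma foata_step_inject:
  assumes "foata_step x v = foata_step x w" "x \<notin> set v"
  shows "v = w"
proof (cases "v = []")
  case True
  then show ?thesis using assms(1) by (metis mset_foata_step mset_zero_iff)
next
  case False
  have w: "w \<noteq> []" "x \<notin> set w"
    using assms False by (metis mset_foata_step mset_zero_iff, metis set_foata_step)
  have last: "hd u < x \<longleftrightarrow> last (foata_step x u) < x" if "u \<noteq> []" "x \<notin> set u" for u
  proof (cases "hd u < x")
    case True
    then show ?thesis
      using last_rot[of "\<lambda>y. y < x" u] starts_step[of x u] that by (simp add: foata_step_def)
  next
    case False
    then show ?thesis
      using last_rot[of "\<lambda>y. x < y" u] starts_step[of x u] that
      by (simp add: foata_step_def)
  qed
  then have "hd v < x \<longleftrightarrow> hd w < x"
    using assms w False by metis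
  then show ?thesis
    using assms False w starts_step[of x v] starts_step[of x w]
    by (auto simp: foata_step_def intro: rot_inject split: if_splits)
qed

lemma foata_inject: "foata v = foata w \<Longrightarrow> distinct v \<Longrightarrow> v = w"
proof (induction v arbitrary: w)
  case Nil
  then show ?case by (metis foata_eq_Nil)
next
  case (Cons x v)
  then obtain w' where w: "w = x # w'" by (cases w) auto
  with Cons have "foata v = foata w'"
    using foata_step_inject by auto
  then show ?case using Cons w by simp
qed

lemma foata_permutations:
  assumes "finite A"
  shows "bij_betw foata (permutations_of_set A) (permutations_of_set A)"
proof -
  have "inj_on foata (permutations_of_set A)"
    by (auto intro!: inj_onI foata_inject dest: permutations_of_setD)
  moreover have "foata ` permutations_of_set A \<subseteq> permutations_of_set A"
    by (auto simp: permutations_of_set_def)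
  ultimately show ?thesis
    by (simp add: bij_betw_def endo_inj_surj)
qed

lemma min_letters_0_Cons:
  "min_letters 0 (x # w) = insert x {v \<in> min_letters 0 w. v < x}"
  by (auto simp: min_letters_def)

text \<open>
  Letters from \<open>x\<close> on cannot prevent a smaller letter from being a left-to-right minimum.
\<close>

lemma min_letters_0_filter:
  "{v \<in> min_letters 0 w. v < x} = min_letters 0 (filter (\<lambda>y. y < x) w)"
proof (induction w)
  case (Cons z w)
  have "{v \<in> min_letters 0 (z # w). v < x} =
      (if z < x then insert z {v \<in> {v \<in> min_letters 0 w. v < x}. v < z}
       else {v \<in> {v \<in> min_letters 0 w. v < x}. v < z})"
    unfolding min_letters_0_Cons by auto
  also have "\<dots> = min_letters 0 (filter (\<lambda>y. y < x) (z # w))"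
    unfolding Cons.IH by (auto simp: min_letters_0_Cons simp flip: Cons.IH)
  finally show ?case .
qed (auto simp: min_letters_def)

lemma min_letters_foata: "distinct w \<Longrightarrow> min_letters 0 (foata w) = min_letters 0 w"
proof (induction w)
  case (Cons x w)
  have "{v \<in> min_letters 0 (foata_step x (foata w)). v < x} = {v \<in> min_letters 0 (foata w). v < x}"
    using Cons.prems by (simp add: min_letters_0_filter filter_foata_step)
  then show ?case using Cons by (simp add: min_letters_0_Cons)
qed simp

lemma precedes_filter: "P a \<Longrightarrow> P b \<Longrightarrow> precedes a b (filter P w) \<longleftrightarrow> precedes a b w"
  by (induction w) auto

lemma precedes_in_set: "precedes a b w \<Longrightarrow> a \<in> set w \<and> b \<in> set w"
  by (induction w) auto

text \<open>
  If neither \<open>v\<close> nor \<open>Suc v\<close> is the prepended letter \<open>x\<close>, then both lie on the same side of it,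
  and the rotation keeps their order.
\<close>

lemma precedes_foata: "distinct w \<Longrightarrow> precedes (Suc v) v (foata w) \<longleftrightarrow> precedes (Suc v) v w"
proof (induction w)
  case (Cons x w)
  have "precedes (Suc v) v (foata_step x (foata w)) \<longleftrightarrow> precedes (Suc v) v w"
  proof (cases "v = x \<or> Suc v = x")
    case True
    then have "\<not> precedes (Suc v) v (foata_step x (foata w))" "\<not> precedes (Suc v) v w"
      using Cons.prems by (auto dest!: precedes_in_set)
    then show ?thesis by simp
  next
    case False
    then consider "Suc v < x" | "x < v" by linarith
    then show ?thesis
    proof cases
      case 1
      then show ?thesis
        using Cons precedes_filter[of "\<lambda>y. y < x" "Suc v" v "foata w"]
          precedes_filter[of "\<lambda>y. y < x" "Suc v" v "foata_step x (foata w)"]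
          filter_foata_step(1)[of x "foata w"] by simp
    next
      case 2
      then show ?thesis
        using Cons precedes_filter[of "\<lambda>y. x < y" "Suc v" v "foata w"]
          precedes_filter[of "\<lambda>y. x < y" "Suc v" v "foata_step x (foata w)"]
          filter_foata_step(2)[of x "foata w"] by simp
    qed
  qed
  then show ?case by auto
qed simp

lemma inv_descents_foata: "distinct w \<Longrightarrow> inv_descents 0 (foata w) = inv_descents 0 w"
  by (simp add: inv_descents_def precedes_foata min_letters_foata)

section \<open>Rank sequences\<close>

text \<open>
  The \<open>i\<close>-th entry is the rank of the \<open>i\<close>-th letter among the first \<open>i\<close> letters of a word; it is
  one more than the corresponding Lehmer code, which counts the smaller letters before it.
\<close>

definition codes :: "nat \<Rightarrow> nat list set" where
  "codes m = {c. length c = m \<and> (\<forall>i<m. 1 \<le> c ! i \<and> c ! i \<le> Suc i)}"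

text \<open>
  How the old letters move up when a new letter \<open>x\<close> is appended to a permutation of an initial
  segment.
\<close>

definition shift :: "nat \<Rightarrow> nat \<Rightarrow> nat" where
  "shift x v = (if v < x then v else Suc v)"

definition word :: "nat list \<Rightarrow> nat list" where
  "word c = fold (\<lambda>x w. map (shift x) w @ [x]) c []"

text \<open>
  The map from permutations of \<open>{1..n + k}\<close> to permutations of \<open>{1..n}\<close>, on the level of rank
  sequences.
\<close>

definition reduce :: "nat \<Rightarrow> nat list \<Rightarrow> nat list" where
  "reduce k c = map (\<lambda>x. max (x - k) 1) (drop k c)"

lemma word_Nil [simp]: "word [] = []"
  by (simp add: word_def)

lemma word_snoc [simp]: "word (c @ [x]) = map (shift x) (word c) @ [x]"
  by (simp add: word_def)

lemma reduce_snoc [simp]: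
  "k \<le> length c \<Longrightarrow> reduce k (c @ [x]) = reduce k c @ [max (x - k) 1]"
  by (simp add: reduce_def)

lemma length_reduce [simp]: "length (reduce k c) = length c - k"
  by (simp add: reduce_def)

lemma length_word [simp]: "length (word c) = length c"
  by (induction c rule: rev_induct) auto

lemma shift_less_iff [simp]: "shift x v < shift x w \<longleftrightarrow> v < w"
  by (auto simp: shift_def)

lemma shift_eq_iff [simp]: "shift x v = shift x w \<longleftrightarrow> v = w"
  by (auto simp: shift_def)

lemma shift_less [simp]: "shift x v < x \<longleftrightarrow> v < x"
  by (auto simp: shift_def)

lemma less_shift [simp]: "x < shift x v \<longleftrightarrow> x \<le> v"
  by (auto simp: shift_def)

lemma shift_neq [simp]: "shift x v \<noteq> x" "x \<noteq> shift x v"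
  by (auto simp: shift_def)

lemma inj_shift: "inj (shift x)"
  by (simp add: inj_def)

lemma codes_0 [simp]: "codes 0 = {[]}"
  by (auto simp: codes_def)

lemma snoc_in_codes [simp]:
  "c @ [x] \<in> codes (Suc m) \<longleftrightarrow> c \<in> codes m \<and> 1 \<le> x \<and> x \<le> Suc m"
  unfolding codes_def by (auto simp: nth_append less_Suc_eq)

lemma codes_SucE:
  assumes "c \<in> codes (Suc m)"
  obtains c' x where "c = c' @ [x]" "c' \<in> codes m" "1 \<le> x" "x \<le> Suc m"
  using assms by (cases c rule: rev_cases) (auto simp: codes_def[of "Suc m"], simp add: codes_def nth_append less_Suc_eq all_conj_distrib)

lemma length_codes: "c \<in> codes m \<Longrightarrow> length c = m"
  by (simp add: codes_def)

lemma codes_Suc: "codes (Suc m) = (\<lambda>(c, x). c @ [x]) ` (codes m \<times> {1..Suc m})"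
  by (auto elim!: codes_SucE)

lemma finite_codes [simp]: "finite (codes m)"
  by (induction m) (auto simp: codes_Suc)

lemma inj_on_snoc: "inj_on (\<lambda>(c, x). c @ [x]) A"
  by (auto intro!: inj_onI)

lemma card_codes: "card (codes m) = fact m"
  by (induction m) (simp_all add: codes_Suc card_image inj_on_snoc card_cartesian_product)

lemma sum_codes_Suc:
  "(\<Sum>c\<in>codes (Suc m). G c) = (\<Sum>c\<in>codes m. \<Sum>x\<in>{1..Suc m}. G (c @ [x]))"
  unfolding codes_Suc by (subst sum.reindex[OF inj_on_snoc]) (simp add: sum.cartesian_product split_def
    del: sum.cl_ivl_Suc)

lemma reduce_codes: "c \<in> codes (n + k) \<Longrightarrow> reduce k c \<in> codes n"
proof -
  assume c: "c \<in> codes (n + k)"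
  have "c ! (k + i) \<le> Suc (k + i)" if "i < n" for i
    using c that by (auto simp: codes_def)
  then show ?thesis using c by (auto simp: codes_def reduce_def le_diff_conv add_ac)
qed

lemma shift_image: "1 \<le> x \<Longrightarrow> x \<le> Suc m \<Longrightarrow> insert x (shift x ` {1..m}) = {1..Suc m}"
proof (intro equalityI subsetI)
  fix v assume "1 \<le> x" "x \<le> Suc m" "v \<in> {1..Suc m}"
  then consider "v = x" | "v < x" "v \<in> {1..m}" | "x < v" "v - 1 \<in> {1..m}"
    by fastforce
  then show "v \<in> insert x (shift x ` {1..m})"
    by cases (auto simp: shift_def image_iff intro: bexI[of _ "v - 1"])
qed (auto simp: shift_def)

lemma word_permutation: "c \<in> codes m \<Longrightarrow> word c \<in> permutations_of_set {1..m}"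
proof (induction m arbitrary: c)
  case (Suc m)
  from Suc.prems obtain c' x where c: "c = c' @ [x]" "c' \<in> codes m" "1 \<le> x" "x \<le> Suc m"
    by (rule codes_SucE)
  then have "distinct (word c')" "set (word c') = {1..m}"
    using Suc.IH by (auto dest: permutations_of_setD)
  then show ?case
    using c shift_image[of x m]
    by (auto intro!: permutations_of_setI simp: distinct_map inj_on_def)
qed simp

lemmas set_word = permutations_of_setD(1)[OF word_permutation]
  and distinct_word = permutations_of_setD(2)[OF word_permutation]

lemma word_inject: "length c = length d \<Longrightarrow> word c = word d \<Longrightarrow> c = d"
proof (induction c arbitrary: d rule: rev_induct)
  case (snoc x c)
  then obtain d' y where d: "d = d' @ [y]" by (cases d rule: rev_cases) auto
  with snoc have "word c = word d'" "x = y"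
    using inj_map_eq_map[OF inj_shift] by auto
  then show ?case using snoc d by auto
qed simp

lemma word_bij: "bij_betw word (codes m) (permutations_of_set {1..m})"
proof -
  have "inj_on word (codes m)"
    by (auto intro!: inj_onI word_inject dest: length_codes)
  moreover have "word ` codes m = permutations_of_set {1..m}"
    using calculation
    by (intro card_subset_eq image_subsetI word_permutation)
      (simp_all add: card_image card_codes)
  ultimately show ?thesis by (simp add: bij_betw_def)
qed

lemma smaller_before_append:
  "v \<in> set w \<Longrightarrow> smaller_before v (w @ u) = smaller_before v w"
  by (induction w) auto

lemma smaller_before_new:
  "v \<notin> set w \<Longrightarrow> smaller_before v (w @ [v]) = length (filter (\<lambda>y. y < v) w)"
  by (induction w) auto

lemma smaller_before_shift [simp]:
  "smaller_before (shift x v) (map (shift x) w) = smaller_before v w"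
  by (induction w) auto

lemma precedes_shift [simp]:
  "precedes (shift x a) (shift x b) (map (shift x) w) \<longleftrightarrow> precedes a b w"
  by (induction w) auto

lemma precedes_snoc:
  "precedes a b (w @ [x]) \<longleftrightarrow> precedes a b w \<or> a \<in> set w \<and> b = x"
  by (induction w) auto

lemma length_filter_word:
  assumes "c \<in> codes m" "x \<le> Suc m"
  shows "length (filter (\<lambda>y. y < x) (word c)) = x - 1"
proof -
  have "set (filter (\<lambda>y. y < x) (word c)) = {1..<x}"
    using assms by (auto simp: set_word)
  then show ?thesis
    using distinct_card[of "filter (\<lambda>y. y < x) (word c)"] distinct_word[OF assms(1)] by simp
qed

text \<open>
  The letters of \<open>word c\<close> are \<open>1, \<dots>, m\<close>, and those below \<open>x\<close> are not moved by
  \<open>shift x\<close>.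
\<close>

lemma smaller_before_last:
  assumes "c \<in> codes m" "x \<le> Suc m"
  shows "smaller_before x (word (c @ [x])) = x - 1"
proof -
  have "x \<notin> set (map (shift x) (word c))" by auto
  then show ?thesis
    using length_filter_word[OF assms] by (simp add: smaller_before_new filter_map o_def)
qed

lemma min_letters_word_snoc:
  assumes "c \<in> codes m" "1 \<le> x" "x \<le> Suc m"
  shows "min_letters k (word (c @ [x])) =
         shift x ` min_letters k (word c) \<union> (if x \<le> Suc k then {x} else {})"
proof -
  have old: "shift x u \<in> min_letters k (word (c @ [x])) \<longleftrightarrow> u \<in> min_letters k (word c)" for u
  proof (cases "u \<in> set (word c)")
    case True
    then have "smaller_before (shift x u) (word (c @ [x])) = smaller_before u (word c)"
      by (simp add: smaller_before_append)
    with True show ?thesis by (simp add: min_letters_def)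
  next
    case False
    then have "shift x u \<notin> set (word (c @ [x]))" by (simp add: image_iff)
    with False show ?thesis by (simp add: min_letters_def)
  qed
  have new: "x \<in> min_letters k (word (c @ [x])) \<longleftrightarrow> x \<le> Suc k"
    unfolding min_letters_def mem_Collect_eq smaller_before_last[OF assms(1,3)] by auto
  show ?thesis
  proof (intro set_eqI)
    fix v
    show "v \<in> min_letters k (word (c @ [x])) \<longleftrightarrow>
        v \<in> shift x ` min_letters k (word c) \<union> (if x \<le> Suc k then {x} else {})"
    proof (cases "v = x")
      case True
      then show ?thesis using new by (simp add: image_iff)
    next
      case False
      have "v \<in> min_letters k (word (c @ [x])) \<Longrightarrow> v \<in> range (shift x)"
        using False by (auto simp: min_letters_def)
      then have "v \<in> min_letters k (word (c @ [x])) \<longleftrightarrow> v \<in> shift x ` min_letters k (word c)"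
        using old by blast
      then show ?thesis using False by simp
    qed
  qed
qed

text \<open>
  The new letter \<open>x\<close> is the last one, hence \<open>Suc x\<close> stands before it whenever it occurs, whereas
  \<open>x - 1\<close> is to the left of \<open>x\<close> and qualifies only if \<open>x\<close> is one of the smallest \<open>Suc k\<close>
  letters. All other pairs of consecutive letters come from consecutive letters of the old word.
\<close>

lemma inv_descents_word_snoc:
  assumes "c \<in> codes m" "1 \<le> x" "x \<le> Suc m"
  shows "v \<in> inv_descents k (word (c @ [x])) \<longleftrightarrow>
         (if Suc v < x then v \<in> inv_descents k (word c)
          else if Suc v = x then 1 \<le> v \<and> x \<le> Suc k
          else if v = x then v \<le> m
          else v - 1 \<in> inv_descents k (word c))" (is "_ \<longleftrightarrow> ?rhs")
proof -
  note w = set_word[OF assms(1)]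
  have cd: "c @ [x] \<in> codes (Suc m)" using assms by simp
  define W where "W = word (c @ [x])"
  have V: "u \<in> set W \<longleftrightarrow> 1 \<le> u \<and> u \<le> Suc m" for u
    unfolding W_def set_word[OF cd] by simp
  have M: "shift x u \<in> min_letters k W \<longleftrightarrow> u \<in> min_letters k (word c)" for u
    unfolding W_def min_letters_word_snoc[OF assms] by auto
  have P: "precedes (shift x u) (shift x u') W \<longleftrightarrow> precedes u u' (word c)" for u u'
    by (simp add: W_def precedes_snoc)
  have I: "v \<in> inv_descents k W \<longleftrightarrow>
      1 \<le> v \<and> v \<le> m \<and> (precedes (Suc v) v W \<or> Suc v \<in> min_letters k W)" for v
    unfolding inv_descents_def by (auto simp: V)
  have I': "v \<in> inv_descents k (word c) \<longleftrightarrow>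
      1 \<le> v \<and> Suc v \<le> m \<and> (precedes (Suc v) v (word c) \<or> Suc v \<in> min_letters k (word c))" for v
    unfolding inv_descents_def w by auto
  consider "Suc v < x" | "Suc v = x" | "v = x" | "x < v" by linarith
  then show ?thesis
    unfolding W_def[symmetric]
  proof cases
    case 1
    then have "shift x v = v" "shift x (Suc v) = Suc v" by (auto simp: shift_def)
    then have "precedes (Suc v) v W \<longleftrightarrow> precedes (Suc v) v (word c)"
      "Suc v \<in> min_letters k W \<longleftrightarrow> Suc v \<in> min_letters k (word c)"
      using M[of "Suc v"] P[of "Suc v" v] by metis+
    then show "v \<in> inv_descents k W \<longleftrightarrow> ?rhs"
      unfolding I I' using 1 assms(3) by auto
  next
    case 2
    have "\<not> precedes x v W"
      using 2 by (auto simp: W_def precedes_snoc dest!: precedes_in_set)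
    moreover have "x \<in> min_letters k W \<longleftrightarrow> x \<le> Suc k"
      unfolding W_def min_letters_word_snoc[OF assms] by auto
    ultimately show "v \<in> inv_descents k W \<longleftrightarrow> ?rhs"
      unfolding I using 2 assms by auto
  next
    case 3
    have "precedes (Suc x) x W" if "x \<le> m"
    proof -
      have "Suc x = shift x x" by (simp add: shift_def)
      moreover have "x \<in> set (word c)" using that assms(2) w by simp
      ultimately show ?thesis by (simp add: W_def precedes_snoc)
    qed
    then show "v \<in> inv_descents k W \<longleftrightarrow> ?rhs"
      unfolding I using 3 assms by auto
  next
    case 4
    then have "shift x (v - 1) = v" "shift x v = Suc v" by (auto simp: shift_def)
    then have "precedes (Suc v) v W \<longleftrightarrow> precedes v (v - 1) (word c)"
      "Suc v \<in> min_letters k W \<longleftrightarrow> v \<in> min_letters k (word c)"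
      using M[of v] P[of v "v - 1"] by metis+
    moreover have "Suc (v - 1) = v" using 4 by simp
    ultimately show "v \<in> inv_descents k W \<longleftrightarrow> ?rhs"
      unfolding I I' using 4 assms by auto
  qed
qed

section \<open>Reduction of the statistics to the case of ordinary descents\<close>

text \<open>
  The letters \<open>1, \<dots>, k\<close> always belong to the set. If the new letter is at most \<open>k\<close>, it pushes
  \<open>k\<close> up to \<open>Suc k\<close> and all larger elements up by one; if it is \<open>Suc k\<close>, it becomes an element
  itself and the larger ones move up. Both have the same effect, which is that of a new letter \<open>1\<close>
  on the reduced side.
\<close>

lemma min_letters_reduce:
  "c \<in> codes (n + k) \<Longrightarrow>
   min_letters k (word c) = {1..k} \<union> (\<lambda>v. v + k) ` min_letters 0 (word (reduce k c))"
proof (induction n arbitrary: c)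
  case 0
  then have "set (word c) = {1..k}" "length (word c) = k" by (simp_all add: set_word length_codes)
  moreover have "smaller_before v w \<le> length w" for v w
    by (induction w) auto
  from this[of _ "word c"] have "min_letters k (word c) = set (word c)"
    using calculation by (auto simp: min_letters_def)
  moreover have "reduce k c = []" using 0 by (simp add: reduce_def length_codes)
  ultimately show ?case by (simp add: min_letters_def)
next
  case (Suc n)
  from Suc.prems have "c \<in> codes (Suc (n + k))" by simp
  then obtain c' x where c: "c = c' @ [x]" "c' \<in> codes (n + k)" "1 \<le> x" "x \<le> Suc (n + k)"
    by (rule codes_SucE)
  define D where "D = min_letters 0 (word (reduce k c'))"
  have D: "1 \<le> v" if "v \<in> D" for v
    using that set_word[OF reduce_codes[OF c(2)]] by (auto simp: D_def min_letters_def)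
  have r: "reduce k c = reduce k c' @ [max (x - k) 1]"
    using c by (simp add: length_codes)
  have "min_letters k (word c) =
      shift x ` ({1..k} \<union> (\<lambda>v. v + k) ` D) \<union> (if x \<le> Suc k then {x} else {})"
    unfolding c(1) min_letters_word_snoc[OF c(2-4)] Suc.IH[OF c(2)] D_def ..
  also have "\<dots> = {1..k} \<union> (\<lambda>v. v + k) `
      (shift (max (x - k) 1) ` D \<union> (if max (x - k) 1 \<le> Suc 0 then {max (x - k) 1} else {}))"
  proof (cases "x \<le> k")
    case True
    have m: "max (x - k) 1 = 1" using True by simp
    have "(\<lambda>v. shift x (v + k)) ` D = (\<lambda>v. shift 1 v + k) ` D"
      using True D by (intro image_cong) (auto simp: shift_def Suc_le_eq)
    then have "shift x ` ({1..k} \<union> (\<lambda>v. v + k) ` D) \<union> {x} =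
        insert x (shift x ` {1..k}) \<union> (\<lambda>v. shift 1 v + k) ` D"
      by (simp only: image_Un image_image Un_insert_right Un_insert_left sup_bot_right)
    also have "insert x (shift x ` {1..k}) = insert (1 + k) {1..k}"
      using True c(3) by (subst shift_image) auto
    also have "\<dots> \<union> (\<lambda>v. shift 1 v + k) ` D =
        {1..k} \<union> (\<lambda>v. v + k) ` (shift 1 ` D \<union> {1})"
      by (simp only: image_Un image_image image_insert image_empty Un_insert_right
          Un_insert_left sup_bot_right)
    finally show ?thesis unfolding m using True by simp
  next
    case False
    have m: "max (x - k) 1 = x - k" using False by simp
    have "shift x ` {1..k} = {1..k}"
      using False by (auto simp: shift_def image_iff)
    moreover have "(\<lambda>v. shift x (v + k)) ` D = (\<lambda>v. shift (x - k) v + k) ` D"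
      using False by (intro image_cong) (auto simp: shift_def)
    ultimately have "shift x ` ({1..k} \<union> (\<lambda>v. v + k) ` D) =
        {1..k} \<union> (\<lambda>v. v + k) ` shift (x - k) ` D"
      by (simp only: image_Un image_image)
    moreover have "(if x \<le> Suc k then {x} else {}) =
        (\<lambda>v. v + k) ` (if x - k \<le> Suc 0 then {x - k} else {})"
      using False by auto
    ultimately show ?thesis unfolding m by (simp only: image_Un Un_assoc)
  qed
  also have "\<dots> = {1..k} \<union> (\<lambda>v. v + k) ` min_letters 0 (word (reduce k c))"
    unfolding r D_def
    by (subst min_letters_word_snoc[OF reduce_codes[OF c(2)]]) (use c(3,4) in simp_all)
  finally show ?case .
qed

text \<open>
  As for \<open>min_letters_reduce\<close>: every \<open>v \<le> k\<close> is an element unless it is the largest letter, so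
  inserting any letter up to \<open>Suc k\<close> creates the element \<open>Suc k\<close> and moves the larger ones up.
\<close>

lemma inv_descents_reduce:
  "c \<in> codes (n + k) \<Longrightarrow>
   v \<in> inv_descents k (word c) \<longleftrightarrow>
   (if v \<le> k then 1 \<le> v \<and> v < n + k else v - k \<in> inv_descents 0 (word (reduce k c)))"
proof (induction n arbitrary: c v)
  case 0
  then have w: "set (word c) = {1..k}" by (simp_all add: set_word)
  have "min_letters k (word c) = {1..k}"
    using min_letters_reduce[of c 0 k] 0 by (simp add: reduce_def length_codes min_letters_def)
  then show ?case
    using 0 w by (auto simp: inv_descents_def reduce_def length_codes)
next
  case (Suc n)
  from Suc.prems have "c \<in> codes (Suc (n + k))" by simp
  then obtain c' x where c: "c = c' @ [x]" "c' \<in> codes (n + k)" "1 \<le> x" "x \<le> Suc (n + k)"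
    by (rule codes_SucE)
  have r: "reduce k c = reduce k c' @ [max (x - k) 1]"
    using c by (simp add: length_codes)
  have big: "max (x - k) 1 \<le> Suc n" using c by auto
  note R = inv_descents_word_snoc[OF reduce_codes[OF c(2)] _ big, of "v - k" 0, folded r]
  note L = inv_descents_word_snoc[OF c(2-4), of v k, folded c(1)]
  show ?case
  proof (cases "v \<le> k")
    case True
    then show ?thesis
      unfolding L using Suc.IH[OF c(2), of v] Suc.IH[OF c(2), of "v - 1"] c by auto
  next
    case False
    show ?thesis
    proof (cases "x \<le> k")
      case True
      then have "v \<in> inv_descents k (word c) \<longleftrightarrow> v - 1 \<in> inv_descents k (word c')"
        using False unfolding L by simp
      also have "\<dots> \<longleftrightarrow> (if v = Suc k then 1 \<le> n else v - k - 1 \<in> inv_descents 0 (word (reduce k c')))"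
        using False True c(3) Suc.IH[OF c(2), of "v - 1"] by (auto simp: diff_right_commute)
      also have "\<dots> \<longleftrightarrow> v - k \<in> inv_descents 0 (word (reduce k c))"
        using True False R by auto
      finally show ?thesis using False by simp
    next
      case x: False
      consider "Suc v < x" | "Suc v = x" | "v = x" | "x < v" by linarith
      then show ?thesis
        using False x Suc.IH[OF c(2), of v] Suc.IH[OF c(2), of "v - 1"] L R
        by cases (auto simp: diff_right_commute)
    qed
  qed
qed

text \<open>
  Of two adjacent letters, the second is the smaller one iff its rank, taken when it is inserted,
  does not exceed that of the first.
\<close>

lemma descent_word:
  "c \<in> codes m \<Longrightarrow> Suc i < m \<Longrightarrow> word c ! Suc i < word c ! i \<longleftrightarrow> c ! Suc i \<le> c ! i"
proof (induction m arbitrary: c)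
  case (Suc m)
  from Suc.prems(1) obtain c' x where c: "c = c' @ [x]" "c' \<in> codes m" "1 \<le> x" "x \<le> Suc m"
    by (rule codes_SucE)
  have last: "word c' ! j = c' ! j" if "length c' = Suc j" for j
    using that by (cases c' rule: rev_cases) (auto simp: nth_append)
  show ?case
  proof (cases "Suc i < m")
    case True
    then show ?thesis using Suc.IH[OF c(2)] c by (auto simp: nth_append length_codes)
  next
    case False
    then show ?thesis
      using Suc.prems(2) c last[of i] by (auto simp: nth_append length_codes)
  qed
qed simp

lemma smaller_before_word:
  "c \<in> codes m \<Longrightarrow> i < m \<Longrightarrow> smaller_before (word c ! i) (word c) = c ! i - 1"
proof (induction m arbitrary: c)
  case (Suc m)
  from Suc.prems(1) obtain c' x where c: "c = c' @ [x]" "c' \<in> codes m" "1 \<le> x" "x \<le> Suc m"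
    by (rule codes_SucE)
  show ?case
  proof (cases "i < m")
    case True
    then show ?thesis using Suc.IH[OF c(2)] c
      by (auto simp: nth_append length_codes smaller_before_append)
  next
    case False
    then show ?thesis
      using Suc.prems(2) c smaller_before_last[OF c(2,4)] by (auto simp: nth_append length_codes)
  qed
qed simp

lemma invs_word: "c \<in> codes m \<Longrightarrow> invs (word c) = (\<Sum>i<m. Suc i - c ! i)"
proof (induction m arbitrary: c)
  case (Suc m)
  from Suc.prems(1) obtain c' x where c: "c = c' @ [x]" "c' \<in> codes m" "1 \<le> x" "x \<le> Suc m"
    by (rule codes_SucE)
  have snoc: "invs (w @ [y]) = invs w + length (filter (\<lambda>v. y < v) w)" for w and y :: nat
    by (induction w) auto
  have shift: "invs (map (shift x) w) = invs w" for w
    by (induction w) (simp_all add: filter_map o_def)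
  have "length (filter (\<lambda>v. x \<le> v) (word c')) = Suc m - x"
    using sum_length_filter_compl[of "\<lambda>v. v < x" "word c'"] length_filter_word[OF c(2,4)] c
    by (simp add: not_less length_codes)
  then show ?case
    using c Suc.IH[OF c(2)]
    by (simp add: snoc shift filter_map o_def nth_append length_codes)
qed simp

lemma rmaj_eq_sum:
  "rmaj w = (\<Sum>i | Suc i < length w \<and> w ! Suc i < w ! i. length w - Suc i)"
proof (induction w)
  case (Cons x w)
  let ?A = "{i. Suc i < length w \<and> w ! Suc i < w ! i}"
  have fin: "finite ?A" by (rule finite_subset[of _ "{..<length w}"]) auto
  have "{i. Suc i < length (x # w) \<and> (x # w) ! Suc i < (x # w) ! i} =
      (if w \<noteq> [] \<and> hd w < x then {0} else {}) \<union> Suc ` ?A" (is "?L = ?R")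
  proof (intro set_eqI)
    fix i show "i \<in> ?L \<longleftrightarrow> i \<in> ?R"
      by (cases i) (auto simp: hd_conv_nth)
  qed
  then show ?case
    using Cons fin by (auto simp: sum.reindex)
qed simp

text \<open>
  In each of the last \<open>n\<close> places an entry above \<open>1\<close> has one preimage \<open>x\<close>, and the entry \<open>1\<close> has
  the preimages \<open>1, \<dots>, Suc k\<close>; the first \<open>k\<close> places are free, which gives the factorial.
\<close>

lemma sum_codes_reduce:
  fixes G :: "nat list \<Rightarrow> 'a :: comm_semiring_1"
  shows "(\<Sum>c\<in>codes (n + k). G (reduce k c)) =
         (\<Sum>c\<in>codes n. of_nat (fact k * Suc k ^ count_list c 1) * G c)"
proof (induction n arbitrary: G)
  case 0
  have "(\<Sum>c\<in>codes k. G (reduce k c)) = (\<Sum>c\<in>codes k. G [])"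
    by (intro sum.cong) (auto simp: reduce_def length_codes)
  then show ?case by (simp add: card_codes)
next
  case (Suc n)
  have split: "(\<Sum>x\<in>{1..Suc (n + k)}. g (max (x - k) 1)) =
      of_nat (Suc k) * g 1 + (\<Sum>y\<in>{2..Suc n}. g y)" for g :: "nat \<Rightarrow> 'a"
  proof -
    have "(\<Sum>x\<in>{1..Suc (n + k)}. g (max (x - k) 1)) =
        (\<Sum>x\<in>{1..Suc k}. g (max (x - k) 1)) + (\<Sum>x\<in>{2 + k..Suc n + k}. g (max (x - k) 1))"
    proof (subst sum.union_disjoint[symmetric])
      have "{1..Suc (n + k)} = {1..Suc k} \<union> {2 + k..Suc n + k}" by auto
      then show "(\<Sum>x\<in>{1..Suc (n + k)}. g (max (x - k) 1)) =
          (\<Sum>x\<in>{1..Suc k} \<union> {2 + k..Suc n + k}. g (max (x - k) 1))"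
        by (simp only:)
    qed auto
    also have "(\<Sum>x\<in>{1..Suc k}. g (max (x - k) 1)) = (\<Sum>x\<in>{1..Suc k}. g 1)"
      by (intro sum.cong) (auto simp: max_def le_Suc_eq)
    also have "(\<Sum>x\<in>{2 + k..Suc n + k}. g (max (x - k) 1)) = (\<Sum>y\<in>{2..Suc n}. g y)"
      by (subst sum.shift_bounds_cl_nat_ivl) (auto intro!: sum.cong simp: max_def)
    finally show ?thesis by simp
  qed
  have "(\<Sum>c\<in>codes (Suc n + k). G (reduce k c)) =
      (\<Sum>c\<in>codes (n + k). \<Sum>x\<in>{1..Suc (n + k)}. G (reduce k c @ [max (x - k) 1]))"
    unfolding add_Suc sum_codes_Suc by (intro sum.cong refl) (simp add: length_codes)
  also have "\<dots> = (\<Sum>c\<in>codes (n + k). of_nat (Suc k) * G (reduce k c @ [1]) +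
      (\<Sum>y\<in>{2..Suc n}. G (reduce k c @ [y])))"
    by (subst split) simp
  also have "\<dots> = (\<Sum>c\<in>codes n. of_nat (fact k * Suc k ^ count_list c 1) *
      (of_nat (Suc k) * G (c @ [1]) + (\<Sum>y\<in>{2..Suc n}. G (c @ [y]))))"
    by (rule Suc.IH)
  also have "\<dots> = (\<Sum>c\<in>codes n. \<Sum>x\<in>{1..Suc n}.
      of_nat (fact k * Suc k ^ count_list (c @ [x]) 1) * G (c @ [x]))"
  proof (intro sum.cong refl)
    fix c
    have "{1..Suc n} = insert 1 {2..Suc n}" by auto
    then show "of_nat (fact k * Suc k ^ count_list c 1) *
        (of_nat (Suc k) * G (c @ [1]) + (\<Sum>y\<in>{2..Suc n}. G (c @ [y]))) =
      (\<Sum>x\<in>{1..Suc n}. of_nat (fact k * Suc k ^ count_list (c @ [x]) 1) * G (c @ [x]))"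
      by (simp add: algebra_simps sum_distrib_left)
  qed
  finally show ?case by (simp add: sum_codes_Suc)
qed

text \<open>
  A letter is a left-to-right minimum iff it has rank \<open>1\<close> when it is inserted.
\<close>

lemma count_list_code:
  "c \<in> codes m \<Longrightarrow> count_list c 1 = card (min_letters 0 (word c))"
proof (induction m arbitrary: c)
  case 0
  then show ?case by (simp add: min_letters_def)
next
  case (Suc m)
  from Suc.prems(1) obtain c' x where c: "c = c' @ [x]" "c' \<in> codes m" "1 \<le> x" "x \<le> Suc m"
    by (rule codes_SucE)
  have "finite (min_letters 0 (word c'))" by (simp add: min_letters_def)
  moreover have "card (shift x ` A) = card A" for A
    by (intro card_image) (auto simp: inj_on_def)
  ultimately show ?case
    using Suc.IH[OF c(2)] c(3) unfolding c(1) min_letters_word_snoc[OF c(2-4)]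
    by (auto simp: card_insert_if)
qed

section \<open>Permutations in one-line notation\<close>

definition one_line :: "nat \<Rightarrow> (nat \<Rightarrow> nat) \<Rightarrow> nat list" where
  "one_line m \<pi> = map \<pi> [1..<Suc m]"

lemma length_one_line [simp]: "length (one_line m \<pi>) = m"
  by (simp add: one_line_def)

lemma nth_one_line [simp]: "i < m \<Longrightarrow> one_line m \<pi> ! i = \<pi> (Suc i)"
  by (simp add: one_line_def nth_append del: upt_Suc)

lemma one_line_permutation:
  assumes "\<pi> permutes {1..m}"
  shows "one_line m \<pi> \<in> permutations_of_set {1..m}"
proof (rule permutations_of_setI)
  have "set [1..<Suc m] = {1..m}" by auto
  then show "set (one_line m \<pi>) = {1..m}" "distinct (one_line m \<pi>)"
    using permutes_image[OF assms] permutes_inj_on[OF assms]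
    by (simp_all add: one_line_def distinct_map del: upt_Suc)
qed

lemma one_line_bij:
  "bij_betw (one_line m) {\<pi>. \<pi> permutes {1..m}} (permutations_of_set {1..m})"
proof -
  have inj: "inj_on (one_line m) {\<pi>. \<pi> permutes {1..m}}"
  proof (intro inj_onI ext, simp only: mem_Collect_eq)
    fix \<pi> \<rho> i assume perm: "\<pi> permutes {1..m}" "\<rho> permutes {1..m}"
      and eq: "one_line m \<pi> = one_line m \<rho>"
    show "\<pi> i = \<rho> i"
    proof (cases "i \<in> {1..m}")
      case True
      have "i - 1 < m" using True by auto
      from nth_one_line[OF this, of \<pi>] nth_one_line[OF this, of \<rho>] show ?thesis
        using True eq by simp
    next
      case False
      then show ?thesis using perm by (simp add: permutes_not_in)
    qed
  qed
  moreover have "one_line m ` {\<pi>. \<pi> permutes {1..m}} = permutations_of_set {1..m}"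
  proof (intro card_subset_eq image_subsetI)
    show "card (one_line m ` {\<pi>. \<pi> permutes {1..m}}) = card (permutations_of_set {1..m})"
      using card_permutations[of "{1..m}" m] by (subst card_image[OF inj]) simp
  qed (use one_line_permutation in simp_all)
  ultimately show ?thesis by (simp add: bij_betw_def)
qed

lemma smaller_before_nth:
  "distinct w \<Longrightarrow> i < length w \<Longrightarrow> smaller_before (w ! i) w = card {j. j < i \<and> w ! j < w ! i}"
proof (induction w arbitrary: i)
  case (Cons x w)
  show ?case
  proof (cases i)
    case (Suc i')
    have "{j. j < i \<and> (x # w) ! j < w ! i'} =
        (if x < w ! i' then {0} else {}) \<union> Suc ` {j. j < i' \<and> w ! j < w ! i'}" (is "?L = ?R")
    proof (intro set_eqI)
      fix j show "j \<in> ?L \<longleftrightarrow> j \<in> ?R" using Suc by (cases j) auto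
    qed
    then show ?thesis using Cons Suc by (auto simp: card_image)
  qed simp
qed simp

lemma precedes_nth:
  "distinct w \<Longrightarrow> i < length w \<Longrightarrow> j < length w \<Longrightarrow> precedes (w ! i) (w ! j) w \<longleftrightarrow> i < j"
proof (induction w arbitrary: i j)
  case (Cons x w)
  have "\<not> precedes a x w" for a
    using Cons.prems(1) by (auto dest: precedes_in_set)
  moreover have "\<not> precedes x b w" for b
    using Cons.prems(1) by (auto dest: precedes_in_set)
  ultimately show ?case
    using Cons by (cases i; cases j) auto
qed simp

context
  fixes m :: nat and \<pi> :: "nat \<Rightarrow> nat"
  assumes perm: "\<pi> permutes {1..m}"
begin

lemma inv_range: "v \<in> {1..m} \<Longrightarrow> inv \<pi> v \<in> {1..m}"
  using permutes_in_image[OF permutes_inv[OF perm]] by simp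

lemma one_line_position: "v \<in> {1..m} \<Longrightarrow> one_line m \<pi> ! (inv \<pi> v - 1) = v"
  using inv_range[of v] permutes_inverses(1)[OF perm, of v]
  by (subst nth_one_line) auto

lemma smaller_before_position:
  assumes "p \<in> {1..m}"
  shows "smaller_before (\<pi> p) (one_line m \<pi>) = card {j \<in> {1..<p}. \<pi> j < \<pi> p}"
proof -
  have p: "p - 1 < m" "one_line m \<pi> ! (p - 1) = \<pi> p"
    using assms by (auto simp: Suc_diff_le)
  have "smaller_before (\<pi> p) (one_line m \<pi>) =
      card {j. j < p - 1 \<and> one_line m \<pi> ! j < \<pi> p}"
    using smaller_before_nth[of "one_line m \<pi>" "p - 1"] p one_line_permutation[OF perm]
    by (auto dest: permutations_of_setD)
  also have "\<dots> = card (Suc ` {j. j < p - 1 \<and> one_line m \<pi> ! j < \<pi> p})"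
    by (simp add: card_image)
  also have "Suc ` {j. j < p - 1 \<and> one_line m \<pi> ! j < \<pi> p} = {j \<in> {1..<p}. \<pi> j < \<pi> p}"
    (is "?L = ?R")
  proof (intro set_eqI)
    fix j show "j \<in> ?L \<longleftrightarrow> j \<in> ?R" using p(1) by (cases j) (auto simp: image_iff)
  qed
  finally show ?thesis .
qed

lemma smaller_before_value:
  assumes "v \<in> {1..m}"
  shows "smaller_before v (one_line m \<pi>) = card {u \<in> {1..<v}. inv \<pi> u < inv \<pi> v}"
proof -
  note inverses = permutes_inverses[OF perm]
  have "bij_betw \<pi> {j \<in> {1..<inv \<pi> v}. \<pi> j < v} {u \<in> {1..<v}. inv \<pi> u < inv \<pi> v}"
  proof (rule bij_betw_byWitness[where f' = "inv \<pi>"])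
    have "\<pi> j \<ge> 1" if "1 \<le> j" "j < inv \<pi> v" for j
      using that inv_range[OF assms] permutes_in_image[OF perm, of j] by auto
    then show "\<pi> ` {j \<in> {1..<inv \<pi> v}. \<pi> j < v} \<subseteq> {u \<in> {1..<v}. inv \<pi> u < inv \<pi> v}"
      using inverses by auto
    have "inv \<pi> u \<ge> 1" if "1 \<le> u" "u < v" for u
      using that assms inv_range[of u] by auto
    then show "inv \<pi> ` {u \<in> {1..<v}. inv \<pi> u < inv \<pi> v} \<subseteq> {j \<in> {1..<inv \<pi> v}. \<pi> j < v}"
      using inverses by auto
  qed (use inverses in auto)
  then show ?thesis
    using smaller_before_position[OF inv_range[OF assms]] inverses
    by (simp add: bij_betw_same_card)
qed

lemma precedes_value:
  assumes "a \<in> {1..m}" "b \<in> {1..m}"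
  shows "precedes a b (one_line m \<pi>) \<longleftrightarrow> inv \<pi> a < inv \<pi> b"
proof -
  have "distinct (one_line m \<pi>)"
    using one_line_permutation[OF perm] by (rule permutations_of_setD)
  moreover have range: "inv \<pi> a - 1 < m" "inv \<pi> b - 1 < m" "1 \<le> inv \<pi> a"
    using inv_range[OF assms(1)] inv_range[OF assms(2)] by auto
  ultimately have "precedes a b (one_line m \<pi>) \<longleftrightarrow> inv \<pi> a - 1 < inv \<pi> b - 1"
    using precedes_nth[of "one_line m \<pi>" "inv \<pi> a - 1" "inv \<pi> b - 1"]
    unfolding one_line_position[OF assms(1)] one_line_position[OF assms(2)] by simp
  then show ?thesis using range(3) by linarith
qed

end

lemma Del_q_inv:
  assumes "\<pi> permutes {1..m}"
  shows "Del_q (Suc k) m (inv \<pi>) = min_letters k (one_line m \<pi>) \<inter> {k + 2..}"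
  using permutations_of_setD(1)[OF one_line_permutation[OF assms]]
  by (auto simp: Del_q_def min_letters_def smaller_before_value[OF assms])

lemma Des_q_inv:
  assumes "\<pi> permutes {1..m}"
  shows "Des_q (Suc k) m (inv \<pi>) = inv_descents k (one_line m \<pi>) \<inter> {Suc k..}"
  using permutations_of_setD(1)[OF one_line_permutation[OF assms]]
  by (auto simp: Des_q_def inv_descents_def Del_q_inv[OF assms] precedes_value[OF assms])

context
  fixes n k :: nat and \<pi> :: "nat \<Rightarrow> nat" and c :: "nat list"
  assumes perm: "\<pi> permutes {1..n + k}" and code: "c \<in> codes (n + k)"
    and word: "word c = one_line (n + k) \<pi>"
begin

lemma nth_reduce: "j < n \<Longrightarrow> reduce k c ! j = max (c ! (k + j) - k) 1"
  using length_codes[OF code] by (simp add: reduce_def)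

lemma code_bounds: "i < n + k \<Longrightarrow> 1 \<le> c ! i \<and> c ! i \<le> Suc i"
  using code by (simp add: codes_def)

lemma card_smaller:
  assumes "i < n + k"
  shows "card {j \<in> {1..<Suc i}. \<pi> j < \<pi> (Suc i)} = c ! i - 1"
  using smaller_before_word[OF code assms] smaller_before_position[OF perm, of "Suc i"] assms
  by (simp add: word)

lemma card_greater:
  assumes "i < n + k"
  shows "card {j \<in> {1..<Suc i}. \<pi> j > \<pi> (Suc i)} = Suc i - c ! i"
proof -
  have "\<pi> j \<noteq> \<pi> (Suc i)" if "j \<in> {1..<Suc i}" for j
    using that permutes_inj[OF perm] by (auto dest: injD)
  then have "{1..<Suc i} = {j \<in> {1..<Suc i}. \<pi> j < \<pi> (Suc i)} \<union> {j \<in> {1..<Suc i}. \<pi> j > \<pi> (Suc i)}"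
    by fastforce
  then have "i = card ({j \<in> {1..<Suc i}. \<pi> j < \<pi> (Suc i)} \<union> {j \<in> {1..<Suc i}. \<pi> j > \<pi> (Suc i)})"
    by (metis card_atLeastLessThan diff_Suc_1)
  also have "\<dots> = card {j \<in> {1..<Suc i}. \<pi> j < \<pi> (Suc i)} + card {j \<in> {1..<Suc i}. \<pi> j > \<pi> (Suc i)}"
    by (intro card_Un_disjoint) auto
  finally show ?thesis
    using card_smaller[OF assms] code_bounds[OF assms] by linarith
qed

text \<open>
  Both the minimum with \<open>i - q\<close> and the passage to \<open>reduce k c\<close> cut off the ranks below \<open>q\<close>. The sum
  on the right has one more term, for the first letter, which is zero.
\<close>

lemma inv_q_reduce: "inv_q (Suc k) (n + k) \<pi> = invs (word (reduce k c))"
proof -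
  have "inv_q (Suc k) (n + k) \<pi> =
      (\<Sum>j\<in>{1..<n}. min j (card {i \<in> {1..<Suc (k + j)}. \<pi> i > \<pi> (Suc (k + j))}))"
    unfolding inv_q_def
    by (rule sum.reindex_bij_witness[of _ "\<lambda>j. Suc (k + j)" "\<lambda>i. i - Suc k"]) auto
  also have "\<dots> = (\<Sum>j\<in>{1..<n}. Suc j - reduce k c ! j)"
  proof (intro sum.cong refl)
    fix j assume j: "j \<in> {1..<n}"
    then have lt: "k + j < n + k" "j < n" by auto
    show "min j (card {i \<in> {1..<Suc (k + j)}. \<pi> i > \<pi> (Suc (k + j))}) = Suc j - reduce k c ! j"
      unfolding card_greater[OF lt(1)] nth_reduce[OF lt(2)]
      using code_bounds[OF lt(1)] by linarith
  qed
  also have "\<dots> = (\<Sum>j<n. Suc j - reduce k c ! j)"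
    by (intro sum.mono_neutral_left) (auto simp: nth_reduce not_le)
  also have "\<dots> = invs (word (reduce k c))"
    using invs_word[OF reduce_codes[OF code]] by simp
  finally show ?thesis .
qed

text \<open>
  A position is a \<open>q\<close>-descent iff the next rank is at most the current one or at most \<open>Suc k\<close>; this
  says that the next rank is at most the current one after both are raised to at least
  \<open>Suc k\<close>.
\<close>

lemma Des_q_reduce:
  "Des_q (Suc k) (n + k) \<pi> =
   (\<lambda>j. Suc (k + j)) ` {j. Suc j < n \<and> word (reduce k c) ! Suc j < word (reduce k c) ! j}"
proof -
  have iff: "Suc (k + j) \<in> Des_q (Suc k) (n + k) \<pi> \<longleftrightarrow>
      word (reduce k c) ! Suc j < word (reduce k c) ! j" if "Suc j < n" for j
  proof -
    have j: "Suc (k + j) < n + k" using that by simp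
    have "\<pi> (Suc (k + j) + 1) < \<pi> (Suc (k + j)) \<longleftrightarrow> c ! Suc (k + j) \<le> c ! (k + j)"
      using descent_word[OF code j] j by (simp add: word)
    moreover have "Suc (k + j) + 1 \<in> Del_q (Suc k) (n + k) \<pi> \<longleftrightarrow> c ! Suc (k + j) \<le> Suc k"
      using card_smaller[OF j] j by (auto simp: Del_q_def)
    ultimately have "Suc (k + j) \<in> Des_q (Suc k) (n + k) \<pi> \<longleftrightarrow>
        c ! Suc (k + j) \<le> c ! (k + j) \<or> c ! Suc (k + j) \<le> Suc k"
      using j by (simp add: Des_q_def)
    also have "\<dots> \<longleftrightarrow> reduce k c ! Suc j \<le> reduce k c ! j"
      using that by (auto simp: nth_reduce)
    also have "\<dots> \<longleftrightarrow> word (reduce k c) ! Suc j < word (reduce k c) ! j"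
      using descent_word[OF reduce_codes[OF code] that] by simp
    finally show ?thesis .
  qed
  show ?thesis
  proof (intro equalityI subsetI)
    fix i assume i: "i \<in> Des_q (Suc k) (n + k) \<pi>"
    then have "Suc (i - Suc k) < n" "i = Suc (k + (i - Suc k))" by (auto simp: Des_q_def)
    with i iff show "i \<in> (\<lambda>j. Suc (k + j)) `
        {j. Suc j < n \<and> word (reduce k c) ! Suc j < word (reduce k c) ! j}"
      by (metis (mono_tags, lifting) image_eqI mem_Collect_eq)
  qed (use iff in auto)
qed

lemma rmaj_q_reduce: "rmaj_q (Suc k) (n + k) \<pi> = rmaj (word (reduce k c))"
  unfolding rmaj_q_def Des_q_reduce rmaj_eq_sum
  using length_codes[OF reduce_codes[OF code]]
  by (subst sum.reindex) (auto simp: inj_on_def intro!: sum.cong)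

lemma Del_q_inv_reduce:
  "Del_q (Suc k) (n + k) (inv \<pi>) =
   (\<lambda>v. v + k) ` min_letters 0 (word (reduce k c)) \<inter> {k + 2..}"
  unfolding Del_q_inv[OF perm] word[symmetric] min_letters_reduce[OF code] by auto

lemma Des_q_inv_reduce:
  "Des_q (Suc k) (n + k) (inv \<pi>) = (\<lambda>v. v + k) ` inv_descents 0 (word (reduce k c))"
proof -
  have pos: "0 \<notin> inv_descents 0 (word (reduce k c))"
    using set_word[OF reduce_codes[OF code]] by (auto simp: inv_descents_def)
  have "v \<in> inv_descents k (word c) \<inter> {Suc k..} \<longleftrightarrow>
      v \<in> (\<lambda>v. v + k) ` inv_descents 0 (word (reduce k c))" for v
  proof (cases "v \<le> k")
    case True
    then show ?thesis using pos by (auto intro: gr0I)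
  next
    case False
    then have "v \<in> (\<lambda>v. v + k) ` S \<longleftrightarrow> v - k \<in> S" for S
      by (auto simp: image_iff intro!: bexI[of _ "v - k"])
    then show ?thesis using False inv_descents_reduce[OF code, of v] by simp
  qed
  then show ?thesis unfolding Des_q_inv[OF perm] word[symmetric] by blast
qed

end

text \<open>
  Sums over permutations of \<open>{1..n + k}\<close> with prescribed \<open>q\<close>-data of the inverse become weighted
  sums over permutations of \<open>{1..n}\<close>, with a weight that depends on the left-to-right minima only.
\<close>

lemma sum_permutations_reduce:
  fixes stat :: "(nat \<Rightarrow> nat) \<Rightarrow> nat" and stat' :: "nat list \<Rightarrow> nat"
  assumes stat: "\<And>\<pi> c. \<pi> permutes {1..n + k} \<Longrightarrow> c \<in> codes (n + k) \<Longrightarrow>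
      word c = one_line (n + k) \<pi> \<Longrightarrow> stat \<pi> = stat' (word (reduce k c))"
  shows "(\<Sum>\<pi> | \<pi> permutes {1..n + k} \<and> Des_q (Suc k) (n + k) (inv \<pi>) = B1 \<and>
              Del_q (Suc k) (n + k) (inv \<pi>) = B2. monom (1 :: int) (stat \<pi>)) =
         (\<Sum>w\<in>permutations_of_set {1..n}.
            of_nat (fact k * Suc k ^ card (min_letters 0 w)) *
            (if (\<lambda>v. v + k) ` inv_descents 0 w = B1 \<and>
                (\<lambda>v. v + k) ` min_letters 0 w \<inter> {k + 2..} = B2
             then monom 1 (stat' w) else 0))"
proof -
  define G where "G w =
      (if (\<lambda>v. v + k) ` inv_descents 0 w = B1 \<and>
          (\<lambda>v. v + k) ` min_letters 0 w \<inter> {k + 2..} = B2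
       then monom (1 :: int) (stat' w) else 0)" for w
  \<comment> \<open>\<open>h \<pi>\<close> is the rank sequence of \<open>\<pi>\<close>.\<close>
  define h where "h \<pi> = inv_into (codes (n + k)) word (one_line (n + k) \<pi>)" for \<pi>
  have h: "bij_betw h {\<pi>. \<pi> permutes {1..n + k}} (codes (n + k))"
    using bij_betw_trans[OF one_line_bij bij_betw_inv_into[OF word_bij]]
    by (simp add: h_def[abs_def] o_def)
  have wh: "word (h \<pi>) = one_line (n + k) \<pi>" if "\<pi> permutes {1..n + k}" for \<pi>
    unfolding h_def using that one_line_permutation bij_betw_inv_into_right[OF word_bij] by blast
  have hc: "h \<pi> \<in> codes (n + k)" if "\<pi> permutes {1..n + k}" for \<pi>
    using bij_betwE[OF h] that by blast
  have "(\<Sum>\<pi> | \<pi> permutes {1..n + k} \<and> Des_q (Suc k) (n + k) (inv \<pi>) = B1 \<and>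
              Del_q (Suc k) (n + k) (inv \<pi>) = B2. monom (1 :: int) (stat \<pi>)) =
      (\<Sum>\<pi> | \<pi> permutes {1..n + k}.
         if Des_q (Suc k) (n + k) (inv \<pi>) = B1 \<and> Del_q (Suc k) (n + k) (inv \<pi>) = B2
         then monom 1 (stat \<pi>) else 0)"
    by (subst sum.inter_filter[symmetric]) (simp_all add: finite_permutations)
  also have "\<dots> = (\<Sum>\<pi> | \<pi> permutes {1..n + k}. G (word (reduce k (h \<pi>))))"
  proof (intro sum.cong refl)
    fix \<pi> assume "\<pi> \<in> {\<pi>. \<pi> permutes {1..n + k}}"
    then have \<pi>: "\<pi> permutes {1..n + k}" by simp
    note related = \<pi> hc[OF \<pi>] wh[OF \<pi>]
    show "(if Des_q (Suc k) (n + k) (inv \<pi>) = B1 \<and> Del_q (Suc k) (n + k) (inv \<pi>) = B2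
         then monom 1 (stat \<pi>) else 0) = G (word (reduce k (h \<pi>)))"
      unfolding G_def Des_q_inv_reduce[OF related] Del_q_inv_reduce[OF related] stat[OF related] ..
  qed
  also have "\<dots> = (\<Sum>c\<in>codes (n + k). G (word (reduce k c)))"
    by (rule sum.reindex_bij_betw[OF h])
  also have "\<dots> = (\<Sum>c\<in>codes n. of_nat (fact k * Suc k ^ count_list c 1) * G (word c))"
    by (rule sum_codes_reduce)
  also have "\<dots> = (\<Sum>c\<in>codes n. of_nat (fact k * Suc k ^ card (min_letters 0 (word c))) * G (word c))"
    by (intro sum.cong refl) (simp add: count_list_code del: One_nat_def)
  also have "\<dots> = (\<Sum>w\<in>permutations_of_set {1..n}.
      of_nat (fact k * Suc k ^ card (min_letters 0 w)) * G w)"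
    by (rule sum.reindex_bij_betw[OF word_bij])
  finally show ?thesis unfolding G_def .
qed

theorem theorem11p5:
  fixes n q :: nat and B1 B2 :: "nat set"
  assumes "n \<ge> 1" and "q \<ge> 1"
    and "B1 \<subseteq> {q..n + q - 1}" and "B2 \<subseteq> {q..n + q - 1}"
  shows
    "(\<Sum>\<pi> | \<pi> permutes {1..n + q - 1} \<and>
            Des_q q (n + q - 1) (inv \<pi>) = B1 \<and> Del_q q (n + q - 1) (inv \<pi>) = B2.
        monom (1 :: int) (inv_q q (n + q - 1) \<pi>)) =
     (\<Sum>\<pi> | \<pi> permutes {1..n + q - 1} \<and>
            Des_q q (n + q - 1) (inv \<pi>) = B1 \<and> Del_q q (n + q - 1) (inv \<pi>) = B2.
        monom (1 :: int) (rmaj_q q (n + q - 1) \<pi>))"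
proof -
  obtain k where q: "q = Suc k" using assms(2) by (cases q) auto
  define g where "g f w =
      of_nat (fact k * Suc k ^ card (min_letters 0 w)) *
      (if (\<lambda>v. v + k) ` inv_descents 0 w = B1 \<and>
          (\<lambda>v. v + k) ` min_letters 0 w \<inter> {k + 2..} = B2
       then monom (1 :: int) (f w) else 0)" for f :: "nat list \<Rightarrow> nat" and w
  have "(\<Sum>w\<in>permutations_of_set {1..n}. g invs w) =
      (\<Sum>w\<in>permutations_of_set {1..n}. g invs (foata w))"
    by (rule sum.reindex_bij_betw[OF foata_permutations, symmetric]) simp
  also have "\<dots> = (\<Sum>w\<in>permutations_of_set {1..n}. g rmaj w)"
  proof (intro sum.cong refl)
    fix w :: "nat list" assume "w \<in> permutations_of_set {1..n}"
    then have "distinct w" by (rule permutations_of_setD)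
    then show "g invs (foata w) = g rmaj w"
      by (simp add: g_def invs_foata min_letters_foata inv_descents_foata)
  qed
  finally have "(\<Sum>w\<in>permutations_of_set {1..n}. g invs w) =
      (\<Sum>w\<in>permutations_of_set {1..n}. g rmaj w)" .
  moreover have "n + q - 1 = n + k" using q by simp
  ultimately show ?thesis
    using sum_permutations_reduce[of n k "inv_q (Suc k) (n + k)" invs B1 B2, OF inv_q_reduce]
      sum_permutations_reduce[of n k "rmaj_q (Suc k) (n + k)" rmaj B1 B2, OF rmaj_q_reduce]
    by (simp only: g_def q)
qed

end
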